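(* Let $\Gamma$ be the dual graph of a good resolution of a complex normal surface singularity whose link is a rational homology sphere. Let $D\in\mathcal G$ with $D\ge0$. Then: (1) $\chi(-D)\ge0$; (2) $\mu(D)\ge g(D)\ge0$; (3) $\mu(Z+D)\ge\mu(Z)$ for any $Z\in\mathcal E^+\setminus\{0\}$.
   Context: Let $E=\sum_{i=1}^nE_i$ be the exceptional curve of the good resolution, with irreducible components $E_i$. Since the link is a rational homology sphere, each $E_i$ is a smooth rational curve and $\Gamma$ is a connected tree. $\mathcal G=\bigoplus_{i=1}^n\mathbb Z E_i$ carries the negative definite intersection pairing $(\cdot,\cdot)$ and the coefficientwise partial order. The Lipman cone is $\mathcal E^+=\{D\in\mathcal G:(D,E_i)\le 0\text{ for all }i\}$; every nonzero element of it has all coefficients strictly positive. The canonical cycle $K\in\mathcal G\otimes\mathbb Q$ is defined by $(K+E_i,E_i)+2=0$ for all $i$, and for $D\in\mathcal G$, $\chi(D)=-\tfrac12(D,D+K)\in\mathbb Z$. For $D=\sum_i m_iE_i\in\mathcal G$ let $|D|=\sum_{i:\,m_i\ne0}E_i$ be its support and $\#(D)$ the number of connected components of $|D|$ (so $\#(0)=0$). For $D\ge0$ the virtual genus is $g(D)=\#(D)+(D,|D|)+\chi(-D)$ and the virtual Milnor number is $\mu(D)=g(D)+\chi(-D)$. For $Z\in\mathcal E^+\setminus\{0\}$ these coincide with the genus and the first Betti number of the page of the Milnor open book associated with $Z$. *)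

theory Defs
  imports "HOL-Analysis.Analysis"
begin

section \<open>Weighted trees and their intersection lattice\<close>

text \<open>
  The dual graph of a good resolution whose exceptional components are smooth rational curves.
  The vertices, i.e. the components \<open>E_v\<close>, are the elements of the finite type \<^typ>\<open>'v\<close>; the lattice
  \<open>\<Oplus>\<^sub>v \<int> E_v\<close> is \<^typ>\<open>int ^ 'v\<close>, with \<open>E_v\<close> the basis vector \<open>axis v 1\<close> and the library's
  componentwise order, and its tensor product with the rationals is \<^typ>\<open>rat ^ 'v\<close>.
\<close>

record 'v dual_graph =
  adj :: "'v \<Rightarrow> 'v \<Rightarrow> bool"
  self_int :: "'v \<Rightarrow> int"

definition intersection_number :: "'v dual_graph \<Rightarrow> 'v \<Rightarrow> 'v \<Rightarrow> int" where
  "intersection_number \<Gamma> u v =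
     (if u = v then self_int \<Gamma> u else if adj \<Gamma> u v then 1 else 0)"

text \<open>Polymorphic in the coefficients, so that it serves both integral and rational cycles.\<close>

definition pairing :: "'v::finite dual_graph \<Rightarrow> 'a::comm_ring_1 ^ 'v \<Rightarrow> 'a ^ 'v \<Rightarrow> 'a" where
  "pairing \<Gamma> x y =
     (\<Sum>u\<in>UNIV. \<Sum>v\<in>UNIV. of_int (intersection_number \<Gamma> u v) * x $ u * y $ v)"

definition has_cycle :: "('v \<Rightarrow> 'v \<Rightarrow> bool) \<Rightarrow> bool" where
  "has_cycle r \<longleftrightarrow>
     (\<exists>vs. 3 \<le> length vs \<and> distinct vs \<and> successively r vs \<and> r (last vs) (hd vs))"

text \<open>
  Topologically, the link is a rational homology sphere exactly when the dual graph is a tree and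
  all components are rational. Conversely, by Grauert's contractibility criterion every graph as
  below is the dual graph of a good resolution of a normal surface singularity.
  The resolution need not be minimal: \<open>self_int \<Gamma> v = -1\<close> is allowed.
\<close>

locale rational_resolution_tree =
  fixes \<Gamma> :: "'v::finite dual_graph"
  assumes adj_irrefl: "\<not> adj \<Gamma> v v"
    and adj_sym: "adj \<Gamma> u v \<Longrightarrow> adj \<Gamma> v u"
    and connected: "(adj \<Gamma>)\<^sup>*\<^sup>* u v"
    and acyclic: "\<not> has_cycle (adj \<Gamma>)"
    and negative_definite: "(D :: int ^ 'v) \<noteq> 0 \<Longrightarrow> pairing \<Gamma> D D < 0"

definition lipman_cone :: "'v::finite dual_graph \<Rightarrow> (int ^ 'v) set" where
  "lipman_cone \<Gamma> = {D. \<forall>v. pairing \<Gamma> D (axis v 1) \<le> 0}"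

section \<open>Canonical cycle and Euler characteristic\<close>

definition is_canonical_cycle :: "'v::finite dual_graph \<Rightarrow> rat ^ 'v \<Rightarrow> bool" where
  "is_canonical_cycle \<Gamma> K \<longleftrightarrow> (\<forall>v. pairing \<Gamma> (K + axis v 1) (axis v 1) + 2 = 0)"

definition canonical_cycle :: "'v::finite dual_graph \<Rightarrow> rat ^ 'v" where
  "canonical_cycle \<Gamma> = (THE K. is_canonical_cycle \<Gamma> K)"

definition rat_cycle :: "int ^ 'v \<Rightarrow> rat ^ 'v" where
  "rat_cycle D = (\<chi> v. of_int (D $ v))"

text \<open>Rational-valued by definition; see \<open>chi_in_Ints\<close> below for integrality.\<close>

definition chi :: "'v::finite dual_graph \<Rightarrow> int ^ 'v \<Rightarrow> rat" where
  "chi \<Gamma> D = - (1/2) * pairing \<Gamma> (rat_cycle D) (rat_cycle D + canonical_cycle \<Gamma>)"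

section \<open>Virtual genus and virtual Milnor number\<close>

definition support :: "int ^ 'v \<Rightarrow> 'v set" where
  "support D = {v. D $ v \<noteq> 0}"

definition reduced_support :: "int ^ 'v \<Rightarrow> int ^ 'v" where
  "reduced_support D = (\<chi> v. if v \<in> support D then 1 else 0)"

text \<open>Vertex sets of the connected components of the subgraph induced on \<open>S\<close>.\<close>

definition induced_components :: "'v dual_graph \<Rightarrow> 'v set \<Rightarrow> 'v set set" where
  "induced_components \<Gamma> S =
     S // {(u, v). u \<in> S \<and> v \<in> S \<and> (\<lambda>x y. x \<in> S \<and> y \<in> S \<and> adj \<Gamma> x y)\<^sup>*\<^sup>* u v}"

definition num_components :: "'v dual_graph \<Rightarrow> int ^ 'v \<Rightarrow> nat" where
  "num_components \<Gamma> D = card (induced_components \<Gamma> (support D))"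

definition virtual_genus :: "'v::finite dual_graph \<Rightarrow> int ^ 'v \<Rightarrow> rat" where
  "virtual_genus \<Gamma> D =
     of_nat (num_components \<Gamma> D) + of_int (pairing \<Gamma> D (reduced_support D)) + chi \<Gamma> (- D)"

definition virtual_milnor :: "'v::finite dual_graph \<Rightarrow> int ^ 'v \<Rightarrow> rat" where
  "virtual_milnor \<Gamma> D = virtual_genus \<Gamma> D + chi \<Gamma> (- D)"

section \<open>Well-definedness of the canonical cycle and integrality\<close>

lemma pairing_rat_cycle: "pairing \<Gamma> (rat_cycle D) (rat_cycle D') = of_int (pairing \<Gamma> D D')"
  by (simp add: pairing_def rat_cycle_def)

lemma pairing_add_left: "pairing \<Gamma> (x + y) z = pairing \<Gamma> x z + pairing \<Gamma> y z"
  by (simp add: pairing_def algebra_simps sum.distrib)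

lemma pairing_add_right: "pairing \<Gamma> x (y + z) = pairing \<Gamma> x y + pairing \<Gamma> x z"
  by (simp add: pairing_def algebra_simps sum.distrib)

lemma pairing_axis_right:
  "pairing \<Gamma> x (axis v 1) = (\<Sum>u\<in>UNIV. of_int (intersection_number \<Gamma> u v) * x $ u)"
proof -
  have "of_int (intersection_number \<Gamma> u w) * x $ u * axis v 1 $ w =
      (if w = v then of_int (intersection_number \<Gamma> u v) * x $ u else 0)" for u w
    by (simp add: axis_def)
  then show ?thesis by (simp add: pairing_def)
qed

lemma pairing_axis_axis: "pairing \<Gamma> (axis v 1) (axis v 1) = of_int (self_int \<Gamma> v)"
proof -
  have "of_int (intersection_number \<Gamma> u v) * axis v 1 $ u =
      (if u = v then of_int (self_int \<Gamma> v) else (0::'a))" for u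
    by (simp add: axis_def intersection_number_def)
  then show ?thesis by (simp add: pairing_axis_right)
qed

lemma is_canonical_cycle_iff:
  "is_canonical_cycle \<Gamma> K \<longleftrightarrow>
     (\<forall>v. pairing \<Gamma> K (axis v 1) = - 2 - of_int (self_int \<Gamma> v))"
proof -
  have "a + b + 2 = 0 \<longleftrightarrow> a = - 2 - b" for a b :: rat
    by linarith
  then show ?thesis
    by (simp only: is_canonical_cycle_def pairing_add_left pairing_axis_axis)
qed

lemma pairing_expand_right:
  "pairing \<Gamma> x y = (\<Sum>v\<in>UNIV. y $ v * pairing \<Gamma> x (axis v 1))"
  unfolding pairing_axis_right
  unfolding pairing_def sum_distrib_left
  by (subst sum.swap) (simp add: mult_ac)

lemma ex_integer_multiple:
  fixes x :: "rat ^ 'v::finite"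
  shows "\<exists>(N::int) D. N > 0 \<and> rat_cycle D = of_int N *s x"
proof -
  define d where "d v = snd (quotient_of (x $ v))" for v
  define n where "n v = fst (quotient_of (x $ v))" for v
  have d: "d v > 0" for v
    by (simp add: d_def quotient_of_denom_pos')
  have x: "x $ v = of_int (n v) / of_int (d v)" for v
    by (rule quotient_of_div) (simp add: n_def d_def)
  define N where "N = (\<Prod>v\<in>UNIV. d v)"
  have N: "N = d v * (\<Prod>w\<in>UNIV - {v}. d w)" for v
    unfolding N_def by (simp add: prod.remove)
  have "of_int (n v * (\<Prod>w\<in>UNIV - {v}. d w)) = of_int N * x $ v" for v
    using d[of v] by (simp add: N[of v] x)
  then have "rat_cycle (\<chi> v. n v * (\<Prod>w\<in>UNIV - {v}. d w)) = of_int N *s x"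
    by (simp add: rat_cycle_def vec_eq_iff)
  moreover have "N > 0"
    unfolding N_def by (rule prod_pos) (use d in simp)
  ultimately show ?thesis by blast
qed

context rational_resolution_tree
begin

lemma intersection_number_sym: "intersection_number \<Gamma> u v = intersection_number \<Gamma> v u"
  using adj_sym by (auto simp: intersection_number_def)

lemma pairing_sym: "pairing \<Gamma> x y = pairing \<Gamma> y x"
  unfolding pairing_def
  by (subst sum.swap) (intro sum.cong refl, subst intersection_number_sym, simp add: mult_ac)

lemma pairing_nondegenerate:
  fixes x :: "rat ^ 'v"
  assumes "\<And>v. pairing \<Gamma> x (axis v 1) = 0"
  shows "x = 0"
proof -
  obtain N D where N: "N > 0" and D: "rat_cycle D = of_int N *s x"
    using ex_integer_multiple by blast
  have "pairing \<Gamma> (of_int N *s x) (axis v 1) = of_int N * pairing \<Gamma> x (axis v 1)" for v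
    by (simp add: pairing_axis_right sum_distrib_left algebra_simps)
  then have "pairing \<Gamma> (rat_cycle D) (rat_cycle D) = 0"
    by (subst pairing_expand_right) (simp add: D assms)
  then have "pairing \<Gamma> D D = 0"
    by (simp add: pairing_rat_cycle)
  then have "D = 0"
    using negative_definite[of D] by force
  then have "of_int N *s x = 0"
    using D by (simp add: rat_cycle_def vec_eq_iff)
  then show ?thesis
    using N by simp
qed

lemma ex1_canonical_cycle: "\<exists>!K. is_canonical_cycle \<Gamma> K"
proof -
  define M :: "rat ^ 'v ^ 'v" where "M = (\<chi> v u. of_int (intersection_number \<Gamma> u v))"
  have M: "M *v x = (\<chi> v. pairing \<Gamma> x (axis v 1))" for x
    by (simp add: M_def matrix_vector_mult_def pairing_axis_right vec_eq_iff)
  have ker: "x = 0" if "M *v x = 0" for x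
    by (rule pairing_nondegenerate) (use that in \<open>simp add: M vec_eq_iff\<close>)
  have "\<exists>B. B ** M = mat 1"
    unfolding matrix_left_invertible_ker using ker by simp
  then obtain B where "B ** M = mat 1" ..
  then have MB: "M ** B = mat 1"
    by (simp add: matrix_left_right_inverse)
  have canon: "is_canonical_cycle \<Gamma> K \<longleftrightarrow> M *v K = (\<chi> v. - 2 - of_int (self_int \<Gamma> v))" for K
    unfolding is_canonical_cycle_iff by (simp add: M vec_eq_iff)
  show ?thesis
  proof (rule ex_ex1I)
    have "M *v (B *v y) = y" for y
      by (simp add: matrix_vector_mul_assoc MB)
    then show "\<exists>K. is_canonical_cycle \<Gamma> K"
      using canon by blast
  next
    fix K L
    assume "is_canonical_cycle \<Gamma> K" "is_canonical_cycle \<Gamma> L"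
    then have "M *v (K - L) = 0"
      by (simp add: canon matrix_vector_mult_diff_distrib)
    then show "K = L"
      using ker[of "K - L"] by simp
  qed
qed

lemma canonical_cycle: "is_canonical_cycle \<Gamma> (canonical_cycle \<Gamma>)"
  unfolding canonical_cycle_def by (rule theI') (rule ex1_canonical_cycle)

lemma pairing_canonical_cycle:
  "pairing \<Gamma> (canonical_cycle \<Gamma>) (axis v 1) = - 2 - of_int (self_int \<Gamma> v)"
  using canonical_cycle unfolding is_canonical_cycle_iff by blast

lemma chi_explicit:
  "2 * chi \<Gamma> D = of_int ((\<Sum>v\<in>UNIV. D $ v * (2 + self_int \<Gamma> v)) - pairing \<Gamma> D D)"
proof -
  have "pairing \<Gamma> (rat_cycle D) (canonical_cycle \<Gamma>) =
      pairing \<Gamma> (canonical_cycle \<Gamma>) (rat_cycle D)"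
    by (rule pairing_sym)
  also have "\<dots> = (\<Sum>v\<in>UNIV. of_int (D $ v) * (- 2 - of_int (self_int \<Gamma> v)))"
    by (subst pairing_expand_right) (simp add: pairing_canonical_cycle rat_cycle_def)
  also have "\<dots> = - of_int (\<Sum>v\<in>UNIV. D $ v * (2 + self_int \<Gamma> v))"
    by (simp add: sum_negf[symmetric] algebra_simps)
  finally show ?thesis
    by (simp add: chi_def pairing_add_right pairing_rat_cycle field_simps)
qed

end

lemma even_symmetric_sum:
  fixes f :: "'b \<Rightarrow> 'b \<Rightarrow> int"
  assumes "finite A" and sym: "\<And>u v. f u v = f v u"
  shows "even ((\<Sum>u\<in>A. \<Sum>v\<in>A. f u v) - (\<Sum>u\<in>A. f u u))"
  using \<open>finite A\<close>
proof induction
  case (insert a A)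
  have "(\<Sum>u\<in>A. f u a) = (\<Sum>u\<in>A. f a u)"
    by (intro sum.cong refl sym)
  then have "(\<Sum>u\<in>insert a A. \<Sum>v\<in>insert a A. f u v) - (\<Sum>u\<in>insert a A. f u u)
      = ((\<Sum>u\<in>A. \<Sum>v\<in>A. f u v) - (\<Sum>u\<in>A. f u u)) + 2 * (\<Sum>u\<in>A. f a u)"
    using insert.hyps by (simp add: sum.distrib)
  with insert.IH show ?case by simp
qed simp

lemma (in rational_resolution_tree) chi_in_Ints: "chi \<Gamma> D \<in> \<int>"
proof -
  define f where "f u v = intersection_number \<Gamma> u v * D $ u * D $ v" for u v
  have "even ((\<Sum>u\<in>UNIV. \<Sum>v\<in>UNIV. f u v) - (\<Sum>u\<in>UNIV. f u u))"
    by (rule even_symmetric_sum) (simp, unfold f_def, subst intersection_number_sym, simp add: mult_ac)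
  moreover have "(\<Sum>u\<in>UNIV. \<Sum>v\<in>UNIV. f u v) = pairing \<Gamma> D D"
    by (simp add: f_def pairing_def)
  moreover have "even ((\<Sum>v\<in>UNIV. D $ v * (2 + self_int \<Gamma> v)) - (\<Sum>u\<in>UNIV. f u u))"
    unfolding sum_subtractf[symmetric]
    by (rule dvd_sum) (simp add: f_def intersection_number_def algebra_simps)
  ultimately have "even ((\<Sum>v\<in>UNIV. D $ v * (2 + self_int \<Gamma> v)) - pairing \<Gamma> D D)"
    by presburger
  then obtain k where "(\<Sum>v\<in>UNIV. D $ v * (2 + self_int \<Gamma> v)) - pairing \<Gamma> D D = 2 * k"
    by (elim evenE)
  then have "chi \<Gamma> D = of_int k"
    using chi_explicit[of D] by simp
  then show ?thesis by simp
qed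

end

theory Submission
  imports Defs
begin

text \<open>
  Since \<open>\<chi>(A + B) = \<chi>(A) + \<chi>(B) - (A, B)\<close>, removing from \<open>D > 0\<close> a component \<open>E\<^sub>v\<close> with
  \<open>(D, E\<^sub>v) < 0\<close>, which exists by negative definiteness, does not increase \<open>\<chi>(-D)\<close>; this gives (1).
  In a forest \<open>\<chi>(|D|) = #(D)\<close>, hence \<open>g(D) = \<chi>(-(D - |D|))\<close>, and (2) follows from (1).
  With \<open>E\<close> the sum of all components, (3) comes from the identity
  \<open>\<mu>(Z + D) - \<mu>(Z) = \<chi>(-D) + g(D) - #(D) + (E - |D|, D) - 2 (Z, D)\<close>: if \<open>|D| \<noteq> E\<close> then every
  connected component of \<open>|D|\<close> has a neighbour outside, so \<open>(E - |D|, D) \<ge> #(D)\<close>; if \<open>|D| = E\<close>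
  then \<open>#(D) = 1\<close> and \<open>(Z, D) < 0\<close>.
\<close>

section \<open>Components of induced subgraphs\<close>

text \<open>The relation inside \<open>induced_components\<close>, without the requirement that the
  end points lie in \<open>S\<close>. By reflexivity \<open>conn \<Gamma> S x x\<close> holds even
  for \<open>x\<close> outside \<open>S\<close>, so membership is tracked separately.\<close>

definition conn :: "'v dual_graph \<Rightarrow> 'v set \<Rightarrow> 'v \<Rightarrow> 'v \<Rightarrow> bool" where
  "conn \<Gamma> S = (\<lambda>x y. x \<in> S \<and> y \<in> S \<and> adj \<Gamma> x y)\<^sup>*\<^sup>*"

text \<open>Supplies the distinct vertices that \<open>has_cycle\<close> demands. Paths are extended
  at the front; if the new vertex already occurs, the part before its occurrence is dropped.\<close>

lemma rtranclp_imp_simple_path: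
  assumes "r\<^sup>*\<^sup>* x y"
  shows "\<exists>vs. vs \<noteq> [] \<and> hd vs = x \<and> last vs = y \<and> distinct vs \<and> successively r vs"
  using assms
proof (induction rule: converse_rtranclp_induct)
  case base
  show ?case by (intro exI[of _ "[y]"]) simp
next
  case (step x w)
  then obtain vs where vs: "vs \<noteq> []" "hd vs = w" "last vs = y" "distinct vs" "successively r vs"
    by blast
  show ?case
  proof (cases "x \<in> set vs")
    case True
    then obtain as bs where "vs = as @ x # bs"
      by (meson split_list)
    with vs show ?thesis
      by (intro exI[of _ "x # bs"]) (auto simp: successively_append_iff)
  next
    case False
    with vs step.hyps show ?thesis
      by (intro exI[of _ "x # vs"]) (auto simp: successively_Cons)
  qed
qed

lemma conn_mono: "conn \<Gamma> S x y \<Longrightarrow> S \<subseteq> T \<Longrightarrow> conn \<Gamma> T x y"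
  unfolding conn_def by (erule mono_rtranclp[rule_format, rotated]) blast

lemma conn_trans: "conn \<Gamma> S x y \<Longrightarrow> conn \<Gamma> S y z \<Longrightarrow> conn \<Gamma> S x z"
  unfolding conn_def by (rule rtranclp_trans)

lemma conn_edge: "x \<in> S \<Longrightarrow> y \<in> S \<Longrightarrow> adj \<Gamma> x y \<Longrightarrow> conn \<Gamma> S x y"
  unfolding conn_def by (rule r_into_rtranclp) blast

text \<open>With \<open>S = UNIV\<close> this propagates a property from one vertex to the whole
  connected tree.\<close>

lemma conn_closed:
  assumes "conn \<Gamma> S x y" "x \<in> A"
    and "\<And>u v. u \<in> A \<Longrightarrow> v \<in> S \<Longrightarrow> adj \<Gamma> u v \<Longrightarrow> v \<in> A"
  shows "y \<in> A"
  using assms(1,2) unfolding conn_def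
  by (induction rule: rtranclp_induct) (use assms(3) in blast)+

lemma induced_components_alt:
  "induced_components \<Gamma> S = (\<lambda>x. {y \<in> S. conn \<Gamma> S x y}) ` S"
  unfolding induced_components_def conn_def quotient_def by auto

text \<open>Each member of \<open>P\<close> is the class of any of its points: closedness confines
  the class to it, connectedness fills it.\<close>

lemma induced_components_eqI:
  assumes "\<Union> P = S"
    and ne: "\<And>A. A \<in> P \<Longrightarrow> A \<noteq> {}"
    and conn: "\<And>A x y. A \<in> P \<Longrightarrow> x \<in> A \<Longrightarrow> y \<in> A \<Longrightarrow> conn \<Gamma> S x y"
    and closed: "\<And>A x y. A \<in> P \<Longrightarrow> x \<in> A \<Longrightarrow> y \<in> S \<Longrightarrow> adj \<Gamma> x y \<Longrightarrow> y \<in> A"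
  shows "induced_components \<Gamma> S = P"
proof -
  have class_eq: "{y \<in> S. conn \<Gamma> S x y} = A" if "A \<in> P" "x \<in> A" for A x
  proof
    show "{y \<in> S. conn \<Gamma> S x y} \<subseteq> A"
      using conn_closed[of \<Gamma> S x _ A] closed that by blast
    show "A \<subseteq> {y \<in> S. conn \<Gamma> S x y}"
      using that conn assms(1) by blast
  qed
  show ?thesis
    unfolding induced_components_alt
  proof (intro equalityI subsetI)
    fix A assume "A \<in> (\<lambda>x. {y \<in> S. conn \<Gamma> S x y}) ` S"
    then obtain x where x: "x \<in> S" "A = {y \<in> S. conn \<Gamma> S x y}" by blast
    then obtain B where "B \<in> P" "x \<in> B" using assms(1) by blast
    with class_eq x show "A \<in> P" by simp
  next
    fix A assume A: "A \<in> P"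
    then obtain x where x: "x \<in> A" using ne by blast
    then have "x \<in> S" using A assms(1) by blast
    with class_eq[OF A x] show "A \<in> (\<lambda>x. {y \<in> S. conn \<Gamma> S x y}) ` S" by blast
  qed
qed

text \<open>Ordered pairs are counted, so this is twice the number of edges of the induced
  subgraph.\<close>

definition adj_count :: "'v dual_graph \<Rightarrow> 'v set \<Rightarrow> int" where
  "adj_count \<Gamma> S = (\<Sum>u\<in>S. \<Sum>v\<in>S. of_bool (adj \<Gamma> u v))"

section \<open>Components of subgraphs of a tree\<close>

context rational_resolution_tree
begin

lemma conn_sym: "conn \<Gamma> S x y \<Longrightarrow> conn \<Gamma> S y x"
  unfolding conn_def
  by (rule sympD[OF symp_rtranclp]) (auto intro!: sympI adj_sym)

lemma Union_induced_components: "\<Union> (induced_components \<Gamma> S) = S"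
  unfolding induced_components_alt by (auto simp: conn_def)

lemma induced_components_conn:
  "A \<in> induced_components \<Gamma> S \<Longrightarrow> x \<in> A \<Longrightarrow> y \<in> A \<Longrightarrow> conn \<Gamma> S x y"
  unfolding induced_components_alt using conn_sym conn_trans by fast

lemma induced_components_closed:
  assumes "A \<in> induced_components \<Gamma> S" "x \<in> A" "conn \<Gamma> S x y" "y \<in> S"
  shows "y \<in> A"
  using assms unfolding induced_components_alt by (auto intro: conn_trans)

lemma induced_components_nonempty: "A \<in> induced_components \<Gamma> S \<Longrightarrow> A \<noteq> {}"
  unfolding induced_components_alt by (auto simp: conn_def)

text \<open>A simple path inside \<open>S\<close> between two different neighbours of
  \<open>a\<close> would close up through \<open>a\<close> to a cycle.\<close>

lemma neighbours_not_conn: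
  assumes "a \<notin> S" "b \<in> S" "adj \<Gamma> a b" "adj \<Gamma> a c" "conn \<Gamma> S b c"
  shows "b = c"
proof (rule ccontr)
  assume "b \<noteq> c"
  let ?r = "\<lambda>x y. x \<in> S \<and> y \<in> S \<and> adj \<Gamma> x y"
  obtain vs where vs: "vs \<noteq> []" "hd vs = b" "last vs = c" "distinct vs" "successively ?r vs"
    using rtranclp_imp_simple_path[OF assms(5)[unfolded conn_def]] by blast
  \<comment> \<open>As \<open>b\<close> and \<open>c\<close> differ, the path has at least two
    vertices; together with \<open>a\<close> this gives the length 3 required of a cycle.\<close>
  obtain w ws where ws: "vs = b # w # ws"
    using vs(1-3) \<open>b \<noteq> c\<close> by (cases vs; cases "tl vs") auto
  have "set vs \<subseteq> S"
    using vs(5) \<open>b \<in> S\<close> unfolding ws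
    by (induction ws arbitrary: b w) (auto simp: successively_Cons)
  then have "distinct (a # vs)"
    using vs(4) \<open>a \<notin> S\<close> by auto
  moreover have "successively (adj \<Gamma>) (a # vs)"
    using vs(1,2) assms(3) successively_mono[OF vs(5), of "adj \<Gamma>"]
    by (simp add: successively_Cons)
  moreover have "adj \<Gamma> (last (a # vs)) (hd (a # vs))"
    using vs(1,3) assms(4) by (simp add: adj_sym)
  moreover have "3 \<le> length (a # vs)"
    by (simp add: ws)
  ultimately have "has_cycle (adj \<Gamma>)"
    unfolding has_cycle_def by blast
  then show False using acyclic by simp
qed

text \<open>
  Adding a vertex \<open>a\<close> merges the components adjacent to \<open>a\<close>, and acyclicity makes these
  correspond to the neighbours of \<open>a\<close>.
\<close>

lemma card_induced_components_insert:
  assumes "a \<notin> S"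
  shows "card (induced_components \<Gamma> (insert a S)) + card {b \<in> S. adj \<Gamma> a b} =
    card (induced_components \<Gamma> S) + 1"
proof -
  define C where "C x = {y \<in> S. conn \<Gamma> S x y}" for x
  define N where "N = {b \<in> S. adj \<Gamma> a b}"
  \<comment> \<open>The component of \<open>a\<close> in the enlarged graph; it absorbs exactly the
    old classes of the neighbours \<open>N\<close> of \<open>a\<close>.\<close>
  define M where "M = insert a (\<Union> (C ` N))"
  have comps: "induced_components \<Gamma> S = C ` S"
    by (simp add: induced_components_alt C_def)
  have NS: "N \<subseteq> S" by (auto simp: N_def)
  have C_self: "x \<in> C x" if "x \<in> S" for x
    using that by (simp add: C_def conn_def)
  \<comment> \<open>Acyclicity enters here: different neighbours of \<open>a\<close> lie in
    different classes.\<close>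
  have "inj_on C N"
  proof (rule inj_onI)
    fix b c assume *: "b \<in> N" "c \<in> N" "C b = C c"
    then have "conn \<Gamma> S b c"
      using C_self[of c] by (auto simp: C_def N_def)
    with * assms show "b = c"
      using neighbours_not_conn by (auto simp: N_def)
  qed
  have "induced_components \<Gamma> (insert a S) = insert M (C ` S - C ` N)"
  proof (rule induced_components_eqI)
    show "\<Union> (insert M (C ` S - C ` N)) = insert a S"
    proof -
      have "\<Union> (C ` S) = S"
        using C_self by (auto simp: C_def)
      moreover have "\<Union> (C ` N) \<union> \<Union> (C ` S - C ` N) = \<Union> (C ` S)"
        using image_mono[OF NS, of C] by (simp only: Un_Diff_cancel Un_absorb1 flip: Union_Un_distrib)
      ultimately show ?thesis
        by (simp add: M_def)
    qed
  next
    fix A assume "A \<in> insert M (C ` S - C ` N)"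
    then show "A \<noteq> {}"
      using C_self by (auto simp: M_def)
  next
    fix A x y assume A: "A \<in> insert M (C ` S - C ` N)" and xy: "x \<in> A" "y \<in> A"
    show "conn \<Gamma> (insert a S) x y"
    proof (cases "A = M")
      case True
      have "conn \<Gamma> (insert a S) a z" if z: "z \<in> M" for z
      proof (cases "z = a")
        case False
        then obtain b where b: "b \<in> S" "adj \<Gamma> a b" "conn \<Gamma> S b z"
          using z by (auto simp: M_def C_def N_def)
        then show ?thesis
          by (meson conn_edge conn_mono conn_trans insertI1 insertI2 subset_insertI)
      qed (simp add: conn_def)
      with True xy show ?thesis
        using conn_trans[OF conn_sym] by metis
    next
      case False
      then have "A \<in> induced_components \<Gamma> S"
        using A comps by auto
      then show ?thesis
        by (rule conn_mono[OF induced_components_conn[OF _ xy] subset_insertI])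
    qed
  next
    fix A x y
    assume A: "A \<in> insert M (C ` S - C ` N)" and x: "x \<in> A"
      and y: "y \<in> insert a S" and adj: "adj \<Gamma> x y"
    show "y \<in> A"
    proof (cases "A = M")
      case True
      consider "y = a" | "y \<in> S" "x = a" | b where "y \<in> S" "b \<in> N" "x \<in> C b"
        using x y True by (auto simp: M_def)
      then show ?thesis
      proof cases
        case 2
        then have "y \<in> N" using adj by (simp add: N_def)
        then show ?thesis using C_self True NS by (auto simp: M_def)
      next
        case 3
        then have "y \<in> C b"
          using adj conn_edge conn_trans by (fastforce simp: C_def)
        then show ?thesis using 3 True by (auto simp: M_def)
      qed (simp add: True M_def)
    next
      case False
      then obtain z where z: "A = C z" "z \<in> S" "C z \<notin> C ` N" using A by auto
      have comp: "A \<in> induced_components \<Gamma> S" using z comps by auto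
      have xS: "x \<in> S" and zx: "conn \<Gamma> S z x" using x z by (simp_all add: C_def)
      show ?thesis
      proof (cases "y = a")
        case True
        \<comment> \<open>An edge from \<open>A\<close> to \<open>a\<close> would put
          \<open>A\<close> among the absorbed classes.\<close>
        then have "x \<in> N" using adj adj_sym xS by (simp add: N_def)
        moreover have "C x = C z"
          using conn_trans[OF zx] conn_trans[OF conn_sym[OF zx]] by (auto simp: C_def)
        ultimately show ?thesis using z by blast
      next
        case False
        then show ?thesis
          using induced_components_closed[OF comp x] conn_edge[OF xS _ adj] y by blast
      qed
    qed
  qed
  moreover have "M \<notin> C ` S"
    using assms by (auto simp: M_def C_def)
  ultimately have "card (induced_components \<Gamma> (insert a S)) = card (C ` S - C ` N) + 1"
    by auto
  also have "card (C ` S - C ` N) = card (C ` S) - card N"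
    using NS \<open>inj_on C N\<close> by (subst card_Diff_subset) (auto simp: card_image)
  finally have "card (induced_components \<Gamma> (insert a S)) = card (C ` S) - card N + 1" .
  \<comment> \<open>Ensures that the subtraction of natural numbers above is not truncated.\<close>
  moreover have "card N \<le> card (C ` S)"
    using card_mono[of "C ` S" "C ` N"] NS \<open>inj_on C N\<close> by (auto simp: card_image)
  ultimately show ?thesis by (simp add: comps N_def)
qed

text \<open>Vertices minus edges, doubled. Adding a vertex with d neighbours adds d edges and
  changes the number of components by 1 - d.\<close>

lemma forest_euler_char:
  "2 * int (card (induced_components \<Gamma> S)) = 2 * int (card S) - adj_count \<Gamma> S"
proof (induction S rule: finite_induct[OF finite])
  case 1
  show ?case by (simp add: induced_components_def adj_count_def)
next
  case (2 a S)
  have deg: "(\<Sum>v\<in>S. of_bool (adj \<Gamma> a v)) = int (card {b \<in> S. adj \<Gamma> a b})"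
    by (simp add: of_bool_def sum.If_cases Int_def)
  have "(\<Sum>u\<in>S. of_bool (adj \<Gamma> u a)) = (\<Sum>v\<in>S. of_bool (adj \<Gamma> a v) :: int)"
    using adj_sym by (intro sum.cong) (auto simp: of_bool_def)
  then have "adj_count \<Gamma> (insert a S) = adj_count \<Gamma> S + 2 * int (card {b \<in> S. adj \<Gamma> a b})"
    using 2 adj_irrefl 
    by (simp add: adj_count_def sum.distrib deg del: sum_of_bool_eq)
  with 2 card_induced_components_insert[of a S] show ?case by simp
qed

section \<open>Connectedness of the tree and boundary vertices\<close>

lemma conn_UNIV: "conn \<Gamma> UNIV x y"
  using connected by (simp add: conn_def)

lemma induced_components_UNIV: "induced_components \<Gamma> UNIV = {UNIV}"
  by (rule induced_components_eqI) (auto simp: conn_UNIV)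

text \<open>A component without an edge leaving \<open>S\<close> would be closed under adjacency,
  hence the whole tree. Choosing one boundary vertex per component is injective because components
  are disjoint.\<close>

lemma card_induced_components_le_boundary:
  assumes "S \<noteq> UNIV"
  shows "card (induced_components \<Gamma> S) \<le> card {u \<in> S. \<exists>v. v \<notin> S \<and> adj \<Gamma> u v}"
proof -
  have "\<exists>u\<in>A. \<exists>v. v \<notin> S \<and> adj \<Gamma> u v" if A: "A \<in> induced_components \<Gamma> S" for A
  proof (rule ccontr)
    assume *: "\<not> ?thesis"
    obtain x where x: "x \<in> A" using induced_components_nonempty A by blast
    have AS: "A \<subseteq> S" using A Union_induced_components by blast
    have "y \<in> A" for y
    proof (rule conn_closed[OF conn_UNIV[of x y] x])
      fix u v assume "u \<in> A" "adj \<Gamma> u v"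
      then show "v \<in> A"
        using * AS induced_components_closed[OF A, of u v] conn_edge[of u S v] by blast
    qed
    then show False using AS assms by auto
  qed
  then obtain p where p: "\<And>A. A \<in> induced_components \<Gamma> S \<Longrightarrow>
      p A \<in> A \<and> (\<exists>v. v \<notin> S \<and> adj \<Gamma> (p A) v)"
    by metis
  have "inj_on p (induced_components \<Gamma> S)"
  proof (rule inj_onI)
    fix A B
    assume *: "A \<in> induced_components \<Gamma> S" "B \<in> induced_components \<Gamma> S" "p A = p B"
    then have "p A \<in> A" "p A \<in> B" using p by metis+
    then have "A \<subseteq> B" "B \<subseteq> A"
      using induced_components_closed induced_components_conn Union_induced_components[of S] *(1,2)
      by blast+
    then show "A = B" by blast
  qed
  then show ?thesis
    by (rule card_inj_on_le) (use p Union_induced_components[of S] in blast, simp)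
qed

section \<open>The Euler characteristic\<close>

lemma pairing_diff_left: "pairing \<Gamma> (x - y) z = pairing \<Gamma> x z - pairing \<Gamma> y z"
  by (simp add: pairing_def algebra_simps sum_subtractf)

lemma pairing_minus_left: "pairing \<Gamma> (- x) y = - pairing \<Gamma> x y"
  by (simp add: pairing_def sum_negf)

lemma pairing_minus_right: "pairing \<Gamma> x (- y) = - pairing \<Gamma> x y"
  by (simp add: pairing_def sum_negf)

text \<open>By \<open>chi_explicit\<close>, \<open>chi\<close> is a linear form minus half of the
  quadratic form; symmetry merges the two cross terms.\<close>

lemma chi_add: "chi \<Gamma> (A + B) = chi \<Gamma> A + chi \<Gamma> B - of_int (pairing \<Gamma> A B)"
proof -
  have "2 * chi \<Gamma> (A + B) = 2 * (chi \<Gamma> A + chi \<Gamma> B - of_int (pairing \<Gamma> A B))"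
    unfolding distrib_left right_diff_distrib chi_explicit
    using pairing_sym[of A B]
    by (simp add: pairing_add_left pairing_add_right distrib_right sum.distrib)
  then show ?thesis by simp
qed

lemma chi_zero: "chi \<Gamma> 0 = 0"
  using chi_add[of 0 0] by (simp add: pairing_def)

lemma chi_uminus: "chi \<Gamma> (- D) = - chi \<Gamma> D - of_int (pairing \<Gamma> D D)"
  using chi_add[of D "- D"] by (simp add: chi_zero pairing_minus_right)

lemma chi_axis: "chi \<Gamma> (axis v 1) = 1"
proof -
  have "(\<Sum>w\<in>UNIV. axis v 1 $ w * (2 + self_int \<Gamma> w)) = 2 + self_int \<Gamma> v"
    by (simp add: axis_def if_distrib[of "\<lambda>x. x * _"] cong: if_cong)
  then show ?thesis
    using chi_explicit[of "axis v 1"] by (simp add: pairing_axis_axis)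
qed

lemma chi_uminus_nonneg: "0 \<le> D \<Longrightarrow> 0 \<le> chi \<Gamma> (- D)"
proof (induction "nat (\<Sum>v\<in>UNIV. D $ v)" arbitrary: D rule: less_induct)
  case less
  have D: "0 \<le> D $ v" for v using less.prems by (simp add: less_eq_vec_def)
  show ?case
  proof (cases "D = 0")
    case True
    then show ?thesis by (simp add: chi_zero)
  next
    case False
    then have "(\<Sum>v\<in>UNIV. D $ v * pairing \<Gamma> D (axis v 1)) < 0"
      using negative_definite[OF False] pairing_expand_right[of \<Gamma> D D] by simp
    \<comment> \<open>A negative sum has a negative term; since the coefficients of \<open>D\<close>
      are nonnegative, the sign comes from the pairing, which is an integer and so at most
      -1.\<close>
    then obtain v where "D $ v * pairing \<Gamma> D (axis v 1) < 0"
      by (metis (no_types, lifting) sum_nonneg not_less)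
    then have v: "0 < D $ v" "pairing \<Gamma> D (axis v 1) \<le> -1"
      using D[of v] by (auto simp: mult_less_0_iff)
    define D' where "D' = D - axis v 1"
    have "0 \<le> D'"
      using D v(1) by (auto simp: less_eq_vec_def D'_def axis_def)
    moreover have "(\<Sum>w\<in>UNIV. D' $ w) = (\<Sum>w\<in>UNIV. D $ w) - 1"
      by (simp add: D'_def sum_subtractf axis_def)
    moreover have "0 < (\<Sum>w\<in>UNIV. D $ w)"
      using D v(1) by (intro sum_pos2[of _ v]) auto
    ultimately have IH: "0 \<le> chi \<Gamma> (- D')"
      by (intro less.hyps) auto
    \<comment> \<open>The self-intersection of the removed component cancels between its
      \<open>chi\<close> and the pairing with \<open>D'\<close>, leaving the change -1 - (D, E_v),
      which is nonnegative.\<close>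
    have "- D = - D' + - axis v 1" by (simp add: D'_def)
    then have "chi \<Gamma> (- D) = chi \<Gamma> (- D') + chi \<Gamma> (- axis v 1) - of_int (pairing \<Gamma> D' (axis v 1))"
      by (simp only: chi_add) (simp add: pairing_minus_left pairing_minus_right)
    also have "\<dots> = chi \<Gamma> (- D') - 1 - of_int (pairing \<Gamma> D (axis v 1))"
      by (simp add: chi_uminus chi_axis D'_def pairing_diff_left)
    finally show ?thesis using IH v(2) by linarith
  qed
qed

text \<open>For a reduced cycle the self-intersections cancel in \<open>chi_explicit\<close>,
  leaving vertices minus edges of the induced forest.\<close>

lemma chi_reduced_support: "chi \<Gamma> (reduced_support D) = of_nat (num_components \<Gamma> D)"
proof -
  define S where "S = support D"
  have R: "reduced_support D $ v = of_bool (v \<in> S)" for v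
    by (simp add: reduced_support_def S_def)
  have "(\<Sum>v\<in>UNIV. intersection_number \<Gamma> u v * reduced_support D $ u * reduced_support D $ v) =
      (if u \<in> S then \<Sum>v\<in>S. intersection_number \<Gamma> u v else 0)" for u
    by (cases "u \<in> S") (simp_all add: R)
  then have "pairing \<Gamma> (reduced_support D) (reduced_support D) =
      (\<Sum>u\<in>UNIV. if u \<in> S then \<Sum>v\<in>S. intersection_number \<Gamma> u v else 0)"
    by (simp add: pairing_def)
  also have "\<dots> = (\<Sum>u\<in>S. \<Sum>v\<in>S. intersection_number \<Gamma> u v)"
    by (simp add: sum.If_cases)
  also have "\<dots> = (\<Sum>u\<in>S. \<Sum>v\<in>S. (if u = v then self_int \<Gamma> u else 0) + of_bool (adj \<Gamma> u v))"
    by (intro sum.cong refl) (auto simp: intersection_number_def adj_irrefl)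
  also have "\<dots> = (\<Sum>u\<in>S. self_int \<Gamma> u) + adj_count \<Gamma> S"
    by (simp add: sum.distrib adj_count_def)
  finally have pairing: "pairing \<Gamma> (reduced_support D) (reduced_support D) =
    (\<Sum>u\<in>S. self_int \<Gamma> u) + adj_count \<Gamma> S" .
  have "(\<Sum>v\<in>UNIV. reduced_support D $ v * (2 + self_int \<Gamma> v)) =
      2 * int (card S) + (\<Sum>u\<in>S. self_int \<Gamma> u)"
    by (simp add: R sum.distrib flip: sum.inter_restrict)
  with pairing have "2 * chi \<Gamma> (reduced_support D) = of_int (2 * int (card S) - adj_count \<Gamma> S)"
    by (simp add: chi_explicit)
  also have "\<dots> = 2 * of_nat (num_components \<Gamma> D)"
    by (simp add: num_components_def S_def flip: forest_euler_char)
  finally show ?thesis by simp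
qed

text \<open>Expanding \<chi>(-D + |D|) by \<open>chi_add\<close> produces the three terms of the
  genus, with #(D) coming from \<chi>(|D|).\<close>

lemma virtual_genus_eq: "virtual_genus \<Gamma> D = chi \<Gamma> (- (D - reduced_support D))"
proof -
  let ?R = "reduced_support D"
  have "- (D - ?R) = - D + ?R" by simp
  then have "chi \<Gamma> (- (D - ?R)) = chi \<Gamma> (- D) + chi \<Gamma> ?R + of_int (pairing \<Gamma> D ?R)"
    by (simp only: chi_add pairing_minus_left of_int_minus diff_minus_eq_add)
  then show ?thesis
    by (simp add: virtual_genus_def chi_reduced_support)
qed

lemma virtual_genus_nonneg:
  assumes "0 \<le> D"
  shows "0 \<le> virtual_genus \<Gamma> D"
proof -
  have "0 \<le> D - reduced_support D"
    using assms by (auto simp: less_eq_vec_def reduced_support_def support_def int_one_le_iff_zero_less order_less_le)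
  then show ?thesis
    unfolding virtual_genus_eq by (rule chi_uminus_nonneg)
qed

section \<open>Adding an effective cycle to an element of the Lipman cone\<close>

text \<open>Split \<open>Z\<close> into positive part \<open>P\<close> and negative part
  \<open>N\<close>. Their supports are disjoint, so (P, N) \<ge> 0; then (Z, N) \<le> 0 forces (N,
  N) \<ge> 0, hence \<open>N = 0\<close>.\<close>

lemma lipman_cone_nonneg:
  assumes "Z \<in> lipman_cone \<Gamma>"
  shows "0 \<le> Z $ v"
proof -
  define P where "P = (\<chi> v. max 0 (Z $ v))"
  define N where "N = (\<chi> v. max 0 (- Z $ v))"
  have "Z = P - N" by (auto simp: P_def N_def vec_eq_iff)
  then have "pairing \<Gamma> Z N = pairing \<Gamma> P N - pairing \<Gamma> N N"
    by (simp add: pairing_diff_left)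
  moreover have "pairing \<Gamma> Z N \<le> 0"
    unfolding pairing_expand_right[of \<Gamma> Z N]
    using assms by (intro sum_nonpos) (auto simp: N_def lipman_cone_def intro: mult_nonneg_nonpos)
  moreover have "0 \<le> pairing \<Gamma> P N"
    unfolding pairing_def
    by (intro sum_nonneg) (auto simp: P_def N_def intersection_number_def max_def mult_nonneg_nonpos)
  ultimately have "N = 0"
    using negative_definite[of N] by force
  then have "N $ v = 0" by simp
  then show ?thesis by (simp add: N_def max_def split: if_splits)
qed

text \<open>The zero set of \<open>Z\<close> is closed under adjacency, so by connectedness one zero
  coefficient would force \<open>Z = 0\<close>.\<close>

lemma lipman_cone_pos:
  assumes "Z \<in> lipman_cone \<Gamma>" "Z \<noteq> 0"
  shows "0 < Z $ v"
proof (rule ccontr)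
  assume "\<not> 0 < Z $ v"
  then have v: "v \<in> {v. Z $ v = 0}"
    using lipman_cone_nonneg[OF assms(1), of v] by simp
  have "w \<in> {v. Z $ v = 0}" for w
  proof (rule conn_closed[OF conn_UNIV[of v w] v])
    fix u x assume u: "u \<in> {v. Z $ v = 0}" and adj: "adj \<Gamma> u x"
    \<comment> \<open>The only possibly negative factor is the self-intersection at
      \<open>u\<close>, and there \<open>Z\<close> vanishes.\<close>
    have nonneg: "0 \<le> intersection_number \<Gamma> y u * Z $ y" for y
      using u lipman_cone_nonneg[OF assms(1), of y] by (simp add: intersection_number_def)
    have "(\<Sum>y\<in>UNIV. intersection_number \<Gamma> y u * Z $ y) \<le> 0"
      using assms(1) by (simp add: lipman_cone_def pairing_axis_right)
    then have "(\<Sum>y\<in>UNIV. intersection_number \<Gamma> y u * Z $ y) = 0"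
      using nonneg by (intro antisym sum_nonneg)
    then have "intersection_number \<Gamma> x u * Z $ x = 0"
      using nonneg by (simp add: sum_nonneg_eq_0_iff)
    then show "x \<in> {v. Z $ v = 0}"
      using adj adj_sym[OF adj] adj_irrefl u by (auto simp: intersection_number_def split: if_splits)
  qed
  then show False using assms(2) by (simp add: vec_eq_iff)
qed

lemma lipman_cone_pairing_nonpos:
  assumes "Z \<in> lipman_cone \<Gamma>" "0 \<le> D"
  shows "pairing \<Gamma> Z D \<le> 0"
  unfolding pairing_expand_right[of \<Gamma> Z D]
  using assms by (intro sum_nonpos) (auto simp: less_eq_vec_def lipman_cone_def intro: mult_nonneg_nonpos)

text \<open>Not all (Z, E_v) vanish, since otherwise (Z, Z) = 0; a nonzero one is negative and
  enters with a positive coefficient.\<close>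

lemma lipman_cone_pairing_neg:
  assumes "Z \<in> lipman_cone \<Gamma>" "Z \<noteq> 0" "\<And>v. 0 < D $ v"
  shows "pairing \<Gamma> Z D < 0"
proof -
  have nonpos: "pairing \<Gamma> Z (axis v 1) \<le> 0" for v
    using assms(1) by (simp add: lipman_cone_def)
  obtain v where "pairing \<Gamma> Z (axis v 1) \<noteq> 0"
  proof (rule ccontr)
    assume "\<not> thesis"
    with that have "pairing \<Gamma> Z (axis v 1) = 0" for v by blast
    then have "pairing \<Gamma> Z Z = 0"
      by (simp add: pairing_expand_right[of \<Gamma> Z Z])
    then show False
      using negative_definite[OF assms(2)] by simp
  qed
  then have "pairing \<Gamma> Z (axis v 1) < 0"
    using nonpos[of v] by simp
  then have "0 < (\<Sum>v\<in>UNIV. - (D $ v * pairing \<Gamma> Z (axis v 1)))"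
    using assms(3) nonpos
    by (intro sum_pos2[of _ v]) (auto simp: mult_pos_neg mult_nonneg_nonpos less_imp_le)
  then show ?thesis
    by (simp add: sum_negf flip: pairing_expand_right)
qed

text \<open>Here \<open>1\<close> is the sum E of all components. At a vertex \<open>v\<close> of
  the support, \<open>c v\<close> counts the neighbours outside, so every boundary vertex
  contributes at least 1 to the pairing.\<close>

lemma num_components_le_pairing:
  assumes "0 \<le> D" "support D \<noteq> UNIV"
  shows "int (num_components \<Gamma> D) \<le> pairing \<Gamma> (1 - reduced_support D) D"
proof -
  define S where "S = support D"
  define c where "c v = pairing \<Gamma> (1 - reduced_support D) (axis v 1)" for v
  have c: "c v = (\<Sum>u\<in>- S. of_bool (adj \<Gamma> u v))" if "v \<in> S" for v
  proof -
    have "c v = (\<Sum>u\<in>UNIV. if u \<in> - S then intersection_number \<Gamma> u v else 0)"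
      unfolding c_def pairing_axis_right
      by (intro sum.cong) (auto simp: reduced_support_def S_def)
    also have "\<dots> = (\<Sum>u\<in>- S. intersection_number \<Gamma> u v)"
      by (simp add: sum.If_cases Compl_eq)
    also have "\<dots> = (\<Sum>u\<in>- S. of_bool (adj \<Gamma> u v))"
      using that by (intro sum.cong) (auto simp: intersection_number_def)
    finally show ?thesis .
  qed
  have D: "1 \<le> D $ v" if "v \<in> S" for v
    using assms(1) that by (auto simp: less_eq_vec_def S_def support_def int_one_le_iff_zero_less order_less_le)
  have le: "of_bool (\<exists>u. u \<notin> S \<and> adj \<Gamma> v u) \<le> D $ v * c v" if v: "v \<in> S" for v
  proof (cases "\<exists>u. u \<notin> S \<and> adj \<Gamma> v u")
    case True
    then obtain u where "u \<notin> S" "adj \<Gamma> u v" using adj_sym by blast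
    then have "0 < c v" unfolding c[OF v] by (intro sum_pos2[of _ u]) auto
    then have "0 < D $ v * c v" using D[OF v] by (intro mult_pos_pos) auto
    with True show ?thesis by simp
  next
    case False
    have "0 \<le> c v" unfolding c[OF v] by (intro sum_nonneg) simp
    with D[OF v] have "0 \<le> D $ v * c v" by simp
    with False show ?thesis by (simp only: of_bool_eq)
  qed
  have "int (num_components \<Gamma> D) \<le> int (card {u \<in> S. \<exists>v. v \<notin> S \<and> adj \<Gamma> u v})"
    using card_induced_components_le_boundary[OF assms(2)] by (simp add: num_components_def S_def)
  also have "\<dots> = (\<Sum>v\<in>S. of_bool (\<exists>u. u \<notin> S \<and> adj \<Gamma> v u))"
    by (simp add: of_bool_def sum.If_cases Int_def)
  also have "\<dots> \<le> (\<Sum>v\<in>S. D $ v * c v)"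
    by (intro sum_mono le)
  also have "\<dots> = (\<Sum>v\<in>UNIV. D $ v * c v)"
    by (intro sum.mono_neutral_left) (auto simp: S_def support_def)
  also have "\<dots> = pairing \<Gamma> (1 - reduced_support D) D"
    unfolding c_def by (rule pairing_expand_right[symmetric])
  finally show ?thesis .
qed

text \<open>At full support |D| is the constant cycle \<open>1\<close>, which no longer varies with
  \<open>D\<close>, so \<open>chi_add\<close> applies to both terms when a cycle is added.\<close>

lemma virtual_milnor_full_support:
  assumes "support D = UNIV"
  shows "virtual_milnor \<Gamma> D = chi \<Gamma> (- D) + chi \<Gamma> (- (D - 1))"
proof -
  have "reduced_support D = 1"
    by (simp add: reduced_support_def assms vec_eq_iff)
  then show ?thesis by (simp add: virtual_milnor_def virtual_genus_eq)
qed

lemma virtual_milnor_add: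
  assumes "Z \<in> lipman_cone \<Gamma>" "Z \<noteq> 0" "0 \<le> D"
  shows "virtual_milnor \<Gamma> (Z + D) = virtual_milnor \<Gamma> Z + chi \<Gamma> (- D) + virtual_genus \<Gamma> D
    + of_int (pairing \<Gamma> (1 - reduced_support D) D - int (num_components \<Gamma> D) - 2 * pairing \<Gamma> Z D)"
proof -
  have "support Z = UNIV"
    using lipman_cone_pos[OF assms(1,2)] by (auto simp: support_def less_le)
  moreover have "Z $ v + D $ v \<noteq> 0" for v
    using add_pos_nonneg[OF lipman_cone_pos[OF assms(1,2)], of "D $ v" v] assms(3)
    by (simp add: less_eq_vec_def)
  then have "support (Z + D) = UNIV"
    by (auto simp: support_def)
  moreover have "- (Z + D) = - Z + - D" "- (Z + D - 1) = - (Z - 1) + - D"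
    by simp_all
  then have "chi \<Gamma> (- (Z + D)) = chi \<Gamma> (- Z) + chi \<Gamma> (- D) - of_int (pairing \<Gamma> Z D)"
    "chi \<Gamma> (- (Z + D - 1)) = chi \<Gamma> (- (Z - 1)) + chi \<Gamma> (- D) - of_int (pairing \<Gamma> Z D)
      + of_int (pairing \<Gamma> 1 D)"
    by (simp_all only: chi_add pairing_minus_left pairing_minus_right pairing_diff_left)
  \<comment> \<open>The expansion yields 2 \<chi>(-D); one copy is rewritten as g(D) - #(D) - (D,
    |D|).\<close>
  ultimately show ?thesis
    using pairing_sym[of D "reduced_support D"]
    by (simp add: virtual_milnor_full_support virtual_genus_def pairing_diff_left)
qed

lemma virtual_milnor_le_add:
  assumes "Z \<in> lipman_cone \<Gamma>" "Z \<noteq> 0" "0 \<le> D"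
  shows "virtual_milnor \<Gamma> Z \<le> virtual_milnor \<Gamma> (Z + D)"
proof -
  have "0 \<le> pairing \<Gamma> (1 - reduced_support D) D - int (num_components \<Gamma> D) - 2 * pairing \<Gamma> Z D"
  proof (cases "support D = UNIV")
    case True
    then have "D $ v \<noteq> 0" for v by (auto simp: support_def)
    then have "0 < D $ v" for v
      using assms(3) by (simp add: less_eq_vec_def order_less_le)
    \<comment> \<open>Integrality gives -2 (Z, D) \<ge> 2, which outweighs the single component
      while E - |D| vanishes.\<close>
    then have "pairing \<Gamma> Z D < 0"
      using lipman_cone_pairing_neg assms by blast
    moreover have "num_components \<Gamma> D = 1"
      by (simp add: num_components_def True induced_components_UNIV)
    moreover have "reduced_support D = 1"
      by (simp add: reduced_support_def True vec_eq_iff)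
    ultimately show ?thesis by (simp add: pairing_def)
  next
    case False
    with num_components_le_pairing lipman_cone_pairing_nonpos assms show ?thesis
      by fastforce
  qed
  then have "(0::rat) \<le> of_int (pairing \<Gamma> (1 - reduced_support D) D
      - int (num_components \<Gamma> D) - 2 * pairing \<Gamma> Z D)"
    by (simp only: of_int_0_le_iff)
  with virtual_milnor_add[OF assms] chi_uminus_nonneg[OF assms(3)] virtual_genus_nonneg[OF assms(3)]
  show ?thesis by linarith
qed

end

theorem theorem4p1p3:
  fixes \<Gamma> :: "'v::finite dual_graph" and D :: "int ^ 'v"
  assumes "rational_resolution_tree \<Gamma>"
    and "D \<ge> 0"
  shows "chi \<Gamma> (- D) \<ge> 0
    \<and> (virtual_milnor \<Gamma> D \<ge> virtual_genus \<Gamma> D \<and> virtual_genus \<Gamma> D \<ge> 0)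
    \<and> (\<forall>Z \<in> lipman_cone \<Gamma> - {0}. virtual_milnor \<Gamma> (Z + D) \<ge> virtual_milnor \<Gamma> Z)"
proof -
  interpret rational_resolution_tree \<Gamma> by fact
  show ?thesis
    \<comment> \<open>The difference of \<mu>(D) and g(D) is \<chi>(-D), so \<mu>(D) \<ge> g(D) is
      the first claim again.\<close>
    using chi_uminus_nonneg virtual_genus_nonneg virtual_milnor_le_add \<open>D \<ge> 0\<close>
    by (simp add: virtual_milnor_def)
qed

end
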